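(* Let $(X,\tau)$ and $(Y,\sigma)$ be topological spaces and let $f \colon (X,\tau) \rightarrow (Y,\sigma)$ be a function. The following conditions are equivalent: (1) $f$ is contra-semicontinuous. (2) $f$ is $\mathcal{B}$-continuous and contra-gs-continuous.
   Context: No separation axioms are assumed and functions are not assumed continuous. For a subset $A$ of a topological space, $\mathrm{Int}(A)$ and $\mathrm{Cl}(A)$ denote interior and closure. $A$ is semi-open if $A \subseteq \mathrm{Cl}(\mathrm{Int}(A))$; semi-closed if its complement is semi-open (equivalently $\mathrm{Int}(\mathrm{Cl}(A)) \subseteq A$). $A$ is a $\mathcal{B}$-set if it is the intersection of an open set and a semi-closed set. The semi-closure $\mathrm{sCl}(A)$ is the intersection of all semi-closed sets containing $A$. $A$ is gs-closed if $\mathrm{sCl}(A) \subseteq U$ whenever $A \subseteq U$ and $U$ is open. A function $f \colon (X,\tau)\to(Y,\sigma)$ is contra-semicontinuous (resp. $\mathcal{B}$-continuous, contra-gs-continuous) if the preimage of every open subset of $Y$ is semi-closed (resp. a $\mathcal{B}$-set, gs-closed) in $X$. *)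

theory Defs
  imports "HOL-Analysis.Abstract_Topology"
begin

definition semi_openin :: "'a topology \<Rightarrow> 'a set \<Rightarrow> bool" where
  "semi_openin X A \<longleftrightarrow> A \<subseteq> topspace X \<and> A \<subseteq> X closure_of (X interior_of A)"

definition semi_closedin :: "'a topology \<Rightarrow> 'a set \<Rightarrow> bool" where
  "semi_closedin X A \<longleftrightarrow> A \<subseteq> topspace X \<and> semi_openin X (topspace X - A)"

lemma semi_closedin_iff_interior_closure:
  "semi_closedin X A \<longleftrightarrow> A \<subseteq> topspace X \<and> X interior_of (X closure_of A) \<subseteq> A"
proof -
  have "X closure_of (X interior_of (topspace X - A))
      = topspace X - X interior_of (X closure_of A)"
    by (simp add: interior_of_complement closure_of_complement)
  then show ?thesis
    using interior_of_subset_topspace[of X "X closure_of A"]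
    unfolding semi_closedin_def semi_openin_def by auto
qed

lemma semi_closedin_topspace: "semi_closedin X (topspace X)"
  by (simp add: semi_closedin_def semi_openin_def)

definition B_setin :: "'a topology \<Rightarrow> 'a set \<Rightarrow> bool" where
  "B_setin X A \<longleftrightarrow> (\<exists>U C. openin X U \<and> semi_closedin X C \<and> A = U \<inter> C)"

text \<open>Used only for subsets of the space: for these the intersected family contains the whole
  space, hence is nonempty.\<close>

definition semi_closure_of :: "'a topology \<Rightarrow> 'a set \<Rightarrow> 'a set" where
  "semi_closure_of X A = \<Inter>{C. semi_closedin X C \<and> A \<subseteq> C}"

definition gs_closedin :: "'a topology \<Rightarrow> 'a set \<Rightarrow> bool" where
  "gs_closedin X A \<longleftrightarrow>
     A \<subseteq> topspace X \<and> (\<forall>U. openin X U \<and> A \<subseteq> U \<longrightarrow> semi_closure_of X A \<subseteq> U)"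

text \<open>The following notions are meant for functions mapping \<open>topspace X\<close> into \<open>topspace Y\<close>;
  preimages are taken relative to \<open>topspace X\<close>, as in \<^const>\<open>continuous_map\<close>.\<close>

definition contra_semicontinuous_map :: "'a topology \<Rightarrow> 'b topology \<Rightarrow> ('a \<Rightarrow> 'b) \<Rightarrow> bool" where
  "contra_semicontinuous_map X Y f \<longleftrightarrow>
     (\<forall>V. openin Y V \<longrightarrow> semi_closedin X {x \<in> topspace X. f x \<in> V})"

definition B_continuous_map :: "'a topology \<Rightarrow> 'b topology \<Rightarrow> ('a \<Rightarrow> 'b) \<Rightarrow> bool" where
  "B_continuous_map X Y f \<longleftrightarrow>
     (\<forall>V. openin Y V \<longrightarrow> B_setin X {x \<in> topspace X. f x \<in> V})"

definition contra_gs_continuous_map :: "'a topology \<Rightarrow> 'b topology \<Rightarrow> ('a \<Rightarrow> 'b) \<Rightarrow> bool" where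
  "contra_gs_continuous_map X Y f \<longleftrightarrow>
     (\<forall>V. openin Y V \<longrightarrow> gs_closedin X {x \<in> topspace X. f x \<in> V})"

end

theory Submission
  imports Defs
begin

text \<open>The equivalence already holds for single sets
  (\<open>semi_closedin_iff_B_setin_gs_closedin\<close>) and is then applied to each preimage of an
  open set. The substantial direction traps the semi-closure of A = U \<inter> C: being gs-closed
  keeps it inside the open U, minimality keeps it inside the semi-closed C, so it lies in A. Since
  it always contains Int(Cl(A)), this forces Int(Cl(A)) \<subseteq> A.\<close>

lemma semi_closure_of_eq:
  assumes "semi_closedin X A"
  shows "semi_closure_of X A = A"
  using assms by (auto simp: semi_closure_of_def)

lemma semi_closure_of_minimal:
  assumes "semi_closedin X C" "A \<subseteq> C"
  shows "semi_closure_of X A \<subseteq> C"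
  using assms by (auto simp: semi_closure_of_def)

text \<open>Any semi-closed C above A satisfies Int(Cl(A)) \<subseteq> Int(Cl(C)) \<subseteq> C by
  monotonicity. This lets semi-closedness of A be read off from sCl(A) \<subseteq> A without showing
  that sCl(A) is semi-closed.\<close>

lemma interior_closure_subset_semi_closure_of:
  "X interior_of (X closure_of A) \<subseteq> semi_closure_of X A"
  unfolding semi_closure_of_def
proof (rule Inter_greatest, clarify)
  fix C x
  assume C: "semi_closedin X C" and "A \<subseteq> C" and x: "x \<in> X interior_of (X closure_of A)"
  then have "X interior_of (X closure_of A) \<subseteq> X interior_of (X closure_of C)"
    by (intro interior_of_mono closure_of_mono)
  with C x show "x \<in> C"
    by (auto simp: semi_closedin_iff_interior_closure)
qed

lemma semi_closedin_iff_B_setin_gs_closedin: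
  "semi_closedin X A \<longleftrightarrow> B_setin X A \<and> gs_closedin X A"
proof
  assume A: "semi_closedin X A"
  then have sub: "A \<subseteq> topspace X"
    by (simp add: semi_closedin_def)
  \<comment> \<open>The whole space serves as the open factor.\<close>
  then have "A = topspace X \<inter> A"
    by blast
  with A have "B_setin X A"
    unfolding B_setin_def using openin_topspace by blast
  moreover from A sub have "gs_closedin X A"
    by (simp add: gs_closedin_def semi_closure_of_eq)
  ultimately show "B_setin X A \<and> gs_closedin X A" ..
next
  assume A: "B_setin X A \<and> gs_closedin X A"
  then obtain U C where U: "openin X U" and C: "semi_closedin X C" and eq: "A = U \<inter> C"
    by (auto simp: B_setin_def)
  from A have sub: "A \<subseteq> topspace X"
    by (simp add: gs_closedin_def)
  \<comment> \<open>The open factor U is itself an open superset of A, so gs-closedness applies to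
    it.\<close>
  from A U eq have "semi_closure_of X A \<subseteq> U"
    by (simp add: gs_closedin_def)
  moreover from C eq have "semi_closure_of X A \<subseteq> C"
    by (simp add: semi_closure_of_minimal)
  ultimately have "semi_closure_of X A \<subseteq> A"
    using eq by blast
  with sub show "semi_closedin X A"
    using interior_closure_subset_semi_closure_of[of X A]
    by (auto simp: semi_closedin_iff_interior_closure)
qed

theorem theorem3p13:
  fixes X :: "'a topology" and Y :: "'b topology" and f :: "'a \<Rightarrow> 'b"
  assumes "f \<in> topspace X \<rightarrow> topspace Y"
  shows "contra_semicontinuous_map X Y f \<longleftrightarrow>
           B_continuous_map X Y f \<and> contra_gs_continuous_map X Y f"
  \<comment> \<open>After the rewriting, only distributing the quantifier over V across the
    conjunction remains.\<close>
  unfolding contra_semicontinuous_map_def B_continuous_map_def contra_gs_continuous_map_def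
    semi_closedin_iff_B_setin_gs_closedin
  by blast

end
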